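(* Let $0\le\alpha<\frac{\pi}{2}$ and let $A\in\mathcal{S}_\alpha$ be an $n\times n$ complex matrix. Then $$w(A)\le\sec\alpha\;w(\Re A).$$
   Context: $\mathcal{M}_n$ is the algebra of complex $n\times n$ matrices. For $A\in\mathcal{M}_n$: $w(A)=\max\{|\langle Ax,x\rangle|:x\in\mathbb{C}^n,\|x\|=1\}$ is the numerical radius, $W(A)=\{\langle Ax,x\rangle:x\in\mathbb{C}^n,\|x\|=1\}$ is the numerical range, and $\Re A=\frac{A+A^*}{2}$. For $0\le\alpha<\pi/2$ let $S_\alpha=\{z\in\mathbb{C}:|\Im z|\le\tan\alpha\,\Re z\}$; we write $A\in\mathcal{S}_\alpha$ if $W(A)\subset S_\alpha$. *)

theory Defs
  imports "HOL-Analysis.Analysis"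
begin

text \<open>
  The class instance of the real inner product for \<open>complex ^ 'n\<close> is only the real part of the
  Hermitian one; its norm is nevertheless the usual Hermitian norm (lemma \<open>hinner_self\<close>).
\<close>

definition hinner :: "complex ^ 'n \<Rightarrow> complex ^ 'n \<Rightarrow> complex" where
  "hinner x y = (\<Sum>i\<in>UNIV. x $ i * cnj (y $ i))"

definition adjoint_mat :: "complex ^ 'n ^ 'n \<Rightarrow> complex ^ 'n ^ 'n" where
  "adjoint_mat A = (\<chi> i j. cnj (A $ j $ i))"

definition Re_mat :: "complex ^ 'n ^ 'n \<Rightarrow> complex ^ 'n ^ 'n" where
  "Re_mat A = (1 / 2) *\<^sub>R (A + adjoint_mat A)"

definition numerical_range :: "complex ^ 'n ^ 'n \<Rightarrow> complex set" where
  "numerical_range A = {hinner (A *v x) x | x. norm x = 1}"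

text \<open>The supremum is a maximum, see \<open>numerical_radius_attained\<close> and \<open>numerical_radius_upper\<close>.\<close>

definition numerical_radius :: "complex ^ 'n ^ 'n \<Rightarrow> real" where
  "numerical_radius A = Sup {cmod (hinner (A *v x) x) | x. norm x = 1}"

definition sector :: "real \<Rightarrow> complex set" where
  "sector \<alpha> = {z. \<bar>Im z\<bar> \<le> tan \<alpha> * Re z}"

definition sectorial_matrices :: "real \<Rightarrow> (complex ^ 'n ^ 'n) set" where
  "sectorial_matrices \<alpha> = {A. numerical_range A \<subseteq> sector \<alpha>}"

lemma hinner_self: "hinner x x = complex_of_real ((norm x)\<^sup>2)"
proof -
  have "hinner x x = (\<Sum>i\<in>UNIV. complex_of_real ((cmod (x $ i))\<^sup>2))"
    unfolding hinner_def by (intro sum.cong refl) (metis complex_norm_square of_real_power)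
  also have "\<dots> = complex_of_real ((norm x)\<^sup>2)"
    by (simp add: norm_vec_def L2_set_def sum_nonneg)
  finally show ?thesis .
qed

lemma compact_numerical_radius_set:
  fixes A :: "complex ^ 'n ^ 'n"
  shows "compact {cmod (hinner (A *v x) x) | x. norm x = 1}"
proof -
  have "{cmod (hinner (A *v x) x) | x. norm x = 1}
      = (\<lambda>x. cmod (hinner (A *v x) x)) ` sphere 0 1"
    by (auto simp: image_iff)
  moreover have "continuous_on (sphere 0 1) (\<lambda>x. cmod (hinner (A *v x) x))"
    unfolding hinner_def matrix_vector_mult_def
    by (simp, intro continuous_intros)
  ultimately show ?thesis
    using compact_continuous_image[OF _ compact_sphere] by metis
qed

lemma numerical_radius_upper:
  fixes A :: "complex ^ 'n ^ 'n"
  assumes "norm x = 1"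
  shows "cmod (hinner (A *v x) x) \<le> numerical_radius A"
  unfolding numerical_radius_def
  using assms
  by (intro cSup_upper)
     (auto intro!: bounded_imp_bdd_above compact_imp_bounded compact_numerical_radius_set)

lemma numerical_radius_attained:
  fixes A :: "complex ^ 'n ^ 'n"
  shows "\<exists>x. norm x = 1 \<and> cmod (hinner (A *v x) x) = numerical_radius A"
proof -
  let ?S = "{cmod (hinner (A *v x) x) | x. norm x = 1}"
  obtain e :: "complex ^ 'n" where "norm e = 1"
    using vector_choose_size[of 1] by auto
  then have "?S \<noteq> {}"
    by auto
  then have "Sup ?S \<in> ?S"
    using compact_numerical_radius_set[of A]
    by (intro closed_contains_Sup bounded_imp_bdd_above compact_imp_bounded compact_imp_closed)
  then show ?thesis
    unfolding numerical_radius_def by force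
qed

end

theory Submission
  imports Defs
begin

text \<open>For a unit vector x put z = <Ax,x>, a point of the sector. Sector membership bounds the
  imaginary part by the real part, giving |z| cos \<alpha> \<le> |Re z|
  (\<open>sector_cmod_le\<close>). Moreover Re z = <(Re A)x,x> (\<open>hinner_Re_mat\<close>), so
  |Re z| is at most w(Re A). Choosing x with |z| = w(A) and dividing by cos \<alpha> > 0 gives the
  bound.\<close>

lemma hinner_add_left: "hinner (x + y) z = hinner x z + hinner y z"
  by (simp add: hinner_def distrib_right sum.distrib)

lemma hinner_scaleR_left: "hinner (r *\<^sub>R x) y = r *\<^sub>R hinner x y"
  by (simp add: hinner_def scaleR_sum_right)

text \<open>The defining relation <A*x,y> = <x,Ay>, with the right side in conjugated form so that y
  = x makes it the conjugate of <Ax,x>.\<close>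

lemma hinner_adjoint_mat: "hinner (adjoint_mat A *v x) y = cnj (hinner (A *v y) x)"
proof -
  have "hinner (adjoint_mat A *v x) y
      = (\<Sum>i\<in>UNIV. \<Sum>j\<in>UNIV. cnj (A $ j $ i) * x $ j * cnj (y $ i))"
    by (simp add: hinner_def adjoint_mat_def matrix_vector_mult_def sum_distrib_right)
  also have "\<dots> = (\<Sum>j\<in>UNIV. \<Sum>i\<in>UNIV. cnj (A $ j $ i) * x $ j * cnj (y $ i))"
    by (rule sum.swap)
  also have "\<dots> = cnj (hinner (A *v y) x)"
    by (simp add: hinner_def matrix_vector_mult_def sum_distrib_left sum_distrib_right mult_ac)
  finally show ?thesis .
qed

lemma scaleR_complex_matrix_vector: "(r *\<^sub>R A) *v x = r *\<^sub>R (A *v x)"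
  for A :: "complex ^ 'n ^ 'm"
  by (simp add: matrix_vector_mult_def vec_eq_iff scaleR_sum_right)

text \<open>The forms of \<open>A\<close> and its adjoint at \<open>x\<close> are conjugate numbers,
  so their mean is a real part.\<close>

lemma hinner_Re_mat: "hinner (Re_mat A *v x) x = complex_of_real (Re (hinner (A *v x) x))"
proof -
  have "hinner (Re_mat A *v x) x = (1 / 2) *\<^sub>R (hinner (A *v x) x + cnj (hinner (A *v x) x))"
    by (simp add: Re_mat_def scaleR_complex_matrix_vector matrix_vector_mult_add_rdistrib
        hinner_scaleR_left hinner_add_left hinner_adjoint_mat)
  then show ?thesis
    by (simp add: complex_add_cnj scaleR_conv_of_real)
qed

text \<open>The absolute value is needed for \<open>\<alpha> = 0\<close>, where the sector is the whole real line.\<close>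

lemma sector_cmod_le:
  assumes "z \<in> sector \<alpha>" and "0 < cos \<alpha>"
  shows "cmod z * cos \<alpha> \<le> \<bar>Re z\<bar>"
proof (rule power2_le_imp_le)
  have "\<bar>Im z\<bar> * cos \<alpha> \<le> sin \<alpha> * Re z"
    using assms by (simp add: sector_def tan_def field_simps)
  then have "(\<bar>Im z\<bar> * cos \<alpha>)\<^sup>2 \<le> (sin \<alpha> * Re z)\<^sup>2"
    using assms(2) by (intro power_mono) auto
  \<comment> \<open>Adding (Re z cos \<alpha>)^2 to both sides completes |z|^2 on the left and sin^2
    + cos^2 on the right.\<close>
  then have "(cmod z * cos \<alpha>)\<^sup>2 \<le> (Re z)\<^sup>2 * ((sin \<alpha>)\<^sup>2 + (cos \<alpha>)\<^sup>2)"
    unfolding distrib_left by (simp add: cmod_power2 power_mult_distrib algebra_simps)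
  then show "(cmod z * cos \<alpha>)\<^sup>2 \<le> \<bar>Re z\<bar>\<^sup>2"
    by simp
qed simp

theorem corollary3p2:
  fixes \<alpha> :: real and A :: "complex ^ 'n ^ 'n"
  assumes "0 \<le> \<alpha>" and "\<alpha> < pi / 2"
    and "A \<in> sectorial_matrices \<alpha>"
  shows "numerical_radius A \<le> (1 / cos \<alpha>) * numerical_radius (Re_mat A)"
proof -
  have cos: "0 < cos \<alpha>"
    using assms(1,2) by (intro cos_gt_zero_pi) auto
  \<comment> \<open>Since the supremum is attained, a pointwise estimate at one maximizer
    suffices.\<close>
  obtain x where x: "norm x = 1" "cmod (hinner (A *v x) x) = numerical_radius A"
    using numerical_radius_attained by blast
  have "hinner (A *v x) x \<in> sector \<alpha>"
    using assms(3) x(1) by (auto simp: sectorial_matrices_def numerical_range_def)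
  then have "numerical_radius A * cos \<alpha> \<le> \<bar>Re (hinner (A *v x) x)\<bar>"
    using sector_cmod_le cos x(2) by metis
  also have "\<dots> \<le> numerical_radius (Re_mat A)"
    using numerical_radius_upper[OF x(1), of "Re_mat A"] by (simp add: hinner_Re_mat)
  finally show ?thesis
    using cos by (simp add: field_simps)
qed

end
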